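(* Let $\alpha>0$ and suppose that $(w^*;y^*;\lambda^* )$, with $w^*=(x_+^*;x_-^*;\xi^* )$ and $y^*=(y_1^*;y_2^*;y_3^* )$, satisfies $$0\in\partial(h+\mathbf{1}_{Z_1})(w^* )+\lambda^*,\qquad 0\in\partial(p+\mathbf{1}_{Z_2})(y^* )-\lambda^*,\qquad w^*-y^*=\alpha\lambda^*,$$ where $h(w)=f_Q(x^+-x^-)+\gamma e^T(e-\xi)$ and $p(y)=g(y_1-y_2)$ are smooth. Assume that $(\xi^*;\xi^*;x_+^*+x_-^* )\ne0$. Then there exist $\mu\in\mathbb{R}$, $\beta_1,\beta_2,\beta_3,\beta_4\in\mathbb{R}^n$, $\pi\in\mathbb{R}^m$ such that $$\begin{pmatrix}\nabla f_Q(x_+^*-x_-^* )+\nabla g(y_1^*-y_2^* )\\-\nabla f_Q(x_+^*-x_-^* )-\nabla g(y_1^*-y_2^* )\\-\gamma e\end{pmatrix}+\begin{pmatrix}\mu\xi^*-\beta_1-A^T\pi\\\mu\xi^*-\beta_2+A^T\pi\\\mu(x_+^*+x_-^* )+\beta_4-\beta_3\end{pmatrix}=0,$$ $$0\le\beta_1\perp y_1^*\ge0,\quad0\le\beta_2\perp y_2^*\ge0,\quad0\le\beta_3\perp y_3^*\ge0,\quad0\le\beta_4\perp e-y_3^*\ge0,$$ $$0\le\pi\perp A(y_1^*-y_2^* )-b\ge0,\qquad(x_+^*+x_-^* )^T\xi^*=0,$$ and $w^*-y^*=\alpha\lambda^*$.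
   Context: Let $A\in\mathbb{R}^{m\times n}$, $b\in\mathbb{R}^m$, $\gamma>0$, $f_Q(x)=x^TMx+d^Tx$ with $M\in\mathbb{R}^{n\times n}$ symmetric and $d\in\mathbb{R}^n$, and $g:\mathbb{R}^n\to\mathbb{R}$ smooth convex. Vectors $w=(x^+;x^-;\xi)$, $y=(y_1;y_2;y_3)$ and $\lambda^*$ are in $\mathbb{R}^{3n}$, with blocks in $\mathbb{R}^n$; $e$ is the all-ones vector; $a\perp c$ means $a_ic_i=0$ for all $i$. Define $$Z_1=\{(x^+;x^-;\xi):(x^++x^-)^T\xi=0\},$$ $$Z_2=\{(x^+;x^-;\xi):x^+\ge0,\ x^-\ge0,\ 0\le\xi_i\le1\ \forall i,\ A(x^+-x^-)\ge b\}.$$ $\mathbf{1}_Z(z)=0$ if $z\in Z$ and $+\infty$ otherwise. For a proper lower semicontinuous $F$, $\partial F(x)$ is the limiting subdifferential (empty for $x\notin\mathrm{dom}\,F$): the set of $v$ for which there exist $x_k\to x$ with $F(x_k)\to F(x)$ and $v_k\to v$ with $v_k$ in the Fréchet subdifferential of $F$ at $x_k$, i.e. $\liminf_{z\to x_k,z\ne x_k}\frac{F(z)-F(x_k)-v_k^T(z-x_k)}{\|z-x_k\|}\ge0$. *)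

theory Defs
  imports "HOL-Analysis.Analysis"
begin

definition grad :: "('a::real_inner \<Rightarrow> real) \<Rightarrow> 'a \<Rightarrow> 'a" where
  "grad f x = (THE D. GDERIV f x :> D)"

(* "Smooth" is read as continuously differentiable, the weakest usual meaning. *)
definition smooth :: "('a::real_inner \<Rightarrow> real) \<Rightarrow> bool" where
  "smooth f \<longleftrightarrow> (\<forall>x. GDERIV f x :> grad f x) \<and> continuous_on UNIV (grad f)"

definition ind :: "'a set \<Rightarrow> 'a \<Rightarrow> ereal" where
  "ind Z z = (if z \<in> Z then 0 else \<infinity>)"

(* The filter "at x" already excludes z = x. The guard makes the set empty outside dom F;
   for proper F, a value of F is finite exactly on dom F. *)
definition frechet_subdiff :: "('a::real_inner \<Rightarrow> ereal) \<Rightarrow> 'a \<Rightarrow> 'a set" where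
  "frechet_subdiff F x = {v. \<bar>F x\<bar> \<noteq> \<infinity> \<and>
     Liminf (at x) (\<lambda>z. (F z - F x - ereal (v \<bullet> (z - x))) / ereal (norm (z - x))) \<ge> 0}"

definition limiting_subdiff :: "('a::real_inner \<Rightarrow> ereal) \<Rightarrow> 'a \<Rightarrow> 'a set" where
  "limiting_subdiff F x = {v. \<bar>F x\<bar> \<noteq> \<infinity> \<and>
     (\<exists>xs vs. xs \<longlonglongrightarrow> x \<and> (\<lambda>k. F (xs k)) \<longlonglongrightarrow> F x \<and> vs \<longlonglongrightarrow> v \<and>
        (\<forall>k. vs k \<in> frechet_subdiff F (xs k)))}"

definition perp :: "real^'k \<Rightarrow> real^'k \<Rightarrow> bool"  (infix "\<bottom>\<bottom>" 50) where
  "a \<bottom>\<bottom> c \<longleftrightarrow> (\<forall>i. a $ i * c $ i = 0)"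

(* Vectors of dimension 3n in block form; the norm and inner product on the product type
   are the Euclidean ones. On real^'k the order is componentwise and the constant 1 is
   the all-ones vector. *)
type_synonym 'n blocks = "(real^'n) \<times> (real^'n) \<times> (real^'n)"

definition f_Q :: "real^'n^'n \<Rightarrow> real^'n \<Rightarrow> real^'n \<Rightarrow> real" where
  "f_Q M d x = x \<bullet> (M *v x) + d \<bullet> x"

definition h_fun :: "real^'n^'n \<Rightarrow> real^'n \<Rightarrow> real \<Rightarrow> 'n::finite blocks \<Rightarrow> real" where
  "h_fun M d \<gamma> = (\<lambda>(xp, xm, \<xi>). f_Q M d (xp - xm) + \<gamma> * (1 \<bullet> (1 - \<xi>)))"

definition p_fun :: "(real^'n \<Rightarrow> real) \<Rightarrow> 'n::finite blocks \<Rightarrow> real" where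
  "p_fun g = (\<lambda>(y1, y2, y3). g (y1 - y2))"

definition Z1 :: "'n::finite blocks set" where
  "Z1 = {(xp, xm, \<xi>). (xp + xm) \<bullet> \<xi> = 0}"

definition Z2 :: "real^'n^'m \<Rightarrow> real^'m \<Rightarrow> 'n::finite blocks set" where
  "Z2 A b = {(xp, xm, \<xi>). xp \<ge> 0 \<and> xm \<ge> 0 \<and> 0 \<le> \<xi> \<and> \<xi> \<le> 1 \<and> A *v (xp - xm) \<ge> b}"

end

theory Submission
  imports Defs
begin

text \<open>
  The two inclusions say that \<open>- lam\<close> and \<open>lam\<close> are limiting subgradients of a smooth function plus
  the indicator of a set. Such a subgradient is the gradient of the smooth part plus a limiting
  normal of the set, so adding the two inclusions cancels \<open>lam\<close> and leaves
  \<^emph>\<open>gradient of h + gradient of p + normal of Z1 + normal of Z2 = 0\<close>. It remains to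
  identify the normals.

  A Frechet normal at a point has nonpositive inner product with every direction along which
  the set contains a short segment (\<open>frechet_subdiff_feasible_direction\<close>). Testing with segments
  suffices for both sets. For \<open>Z1\<close>, defined by the bilinear equation
  \<open>(xp + xm) \<bullet> \<xi> = 0\<close>, enough whole lines stay in the set to force every Frechet normal to be a
  multiple of the gradient \<open>(\<xi>, \<xi>, xp + xm)\<close> of the equation (\<open>Z1_normal_gradient_multiple\<close>).
  Being a multiple of the gradient survives the limit because
  the gradient at the limit point is nonzero (\<open>limit_of_multiples\<close>).

  The set \<open>Z2\<close> is convex, so the segments to all of its points show that a normal is maximised
  over \<open>Z2\<close> at the base point, and this inequality passes to the limit (\<open>p_plus_Z2_normal\<close>).
  Since \<open>Z2\<close> is a polyhedron, Farkas' lemma, obtained by separating a point from a closed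
  finitely generated cone, writes the normal as a nonnegative combination of the active
  constraint normals (\<open>polyhedron_normal_multipliers\<close>). Its coefficients are
  \<open>\<beta>1\<close>, \<open>\<beta>2\<close>, \<open>\<beta>3\<close>, \<open>\<beta>4\<close> and \<open>\<pi>\<close>.
\<close>

section \<open>Subgradients of a smooth function restricted to a set\<close>

lemma frechet_subdiff_ind_mem:
  assumes "v \<in> frechet_subdiff (\<lambda>w. ereal (f w) + ind Z w) x"
  shows "x \<in> Z"
proof (rule ccontr)
  assume "x \<notin> Z"
  with assms show False by (simp add: frechet_subdiff_def ind_def)
qed

text \<open>
  Along the segment in direction \<open>t\<close> the indicator vanishes, so the difference quotient in the
  definition of the Frechet subdifferential tends to \<open>(D - v) \<bullet> t / norm t\<close>, and its lower limit
  is nonnegative.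
\<close>
lemma frechet_subdiff_feasible_direction:
  fixes f :: "'a::real_inner \<Rightarrow> real"
  assumes v: "v \<in> frechet_subdiff (\<lambda>w. ereal (f w) + ind Z w) x"
    and D: "GDERIV f x :> D"
    and feas: "\<forall>\<^sub>F s in at_right 0. x + s *\<^sub>R t \<in> Z"
  shows "(v - D) \<bullet> t \<le> 0"
proof (cases "t = 0")
  case False
  have xZ: "x \<in> Z" using v by (rule frechet_subdiff_ind_mem)
  define q where "q s = (f (x + s *\<^sub>R t) - f x) / s" for s
  have "((\<lambda>s. f (x + s *\<^sub>R t)) has_derivative (\<lambda>s. (s *\<^sub>R t) \<bullet> D)) (at 0)"
  proof -
    have "((\<lambda>s. x + s *\<^sub>R t) has_derivative (\<lambda>s. s *\<^sub>R t)) (at 0)"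
      by (auto intro!: derivative_eq_intros)
    moreover have "(f has_derivative (\<lambda>h. h \<bullet> D)) (at (x + 0 *\<^sub>R t))"
      using D by (simp add: gderiv_def)
    ultimately show ?thesis
      by (rule has_derivative_compose)
  qed
  then have "((\<lambda>s. f (x + s *\<^sub>R t)) has_field_derivative (D \<bullet> t)) (at 0)"
    by (simp add: has_field_derivative_def inner_commute mult.commute[of _ "D \<bullet> t"])
  then have "(q \<longlongrightarrow> D \<bullet> t) (at 0)"
    by (simp add: DERIV_def q_def[abs_def])
  then have q_lim: "(q \<longlongrightarrow> D \<bullet> t) (at_right 0)"
    by (simp add: filterlim_at_split)
  have curve: "filterlim (\<lambda>s. x + s *\<^sub>R t) (at x) (at_right 0)"
  proof -
    have "((\<lambda>s. x + s *\<^sub>R t) \<longlongrightarrow> x + 0 *\<^sub>R t) (at_right 0)"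
      by (intro tendsto_intros)
    moreover have "\<forall>\<^sub>F s in at_right (0::real). x + s *\<^sub>R t \<noteq> x"
      using eventually_at_right_less[of 0] by eventually_elim (use False in auto)
    ultimately show ?thesis by (simp add: filterlim_at)
  qed
  have "v \<bullet> t \<le> D \<bullet> t + e" if "e > 0" for e
  proof -
    define \<epsilon> where "\<epsilon> = e / norm t"
    have "\<epsilon> > 0" using that False by (simp add: \<epsilon>_def)
    define F where "F = (\<lambda>w. ereal (f w) + ind Z w)"
    have "\<forall>\<^sub>F z in at x. ereal (-\<epsilon>) < (F z - F x - ereal (v \<bullet> (z - x))) / ereal (norm (z - x))"
      using v \<open>\<epsilon> > 0\<close> by (auto simp: frechet_subdiff_def le_Liminf_iff F_def)
    with curve have "\<forall>\<^sub>F s in at_right 0. ereal (-\<epsilon>) <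
        (F (x + s *\<^sub>R t) - F x - ereal (v \<bullet> (s *\<^sub>R t))) / ereal (norm (s *\<^sub>R t))"
      by (auto simp: filterlim_iff dest: spec)
    then have "\<forall>\<^sub>F s in at_right 0. v \<bullet> t - e \<le> q s"
      using feas eventually_at_right_less[of 0]
    proof eventually_elim
      case (elim s)
      then have "-\<epsilon> < (f (x + s *\<^sub>R t) - f x - s * (v \<bullet> t)) / (s * norm t)"
        using xZ False by (simp add: F_def ind_def)
      also have "\<dots> = (q s - v \<bullet> t) / norm t"
        using elim(3) by (simp add: q_def field_simps)
      finally show ?case using False by (simp add: \<epsilon>_def field_simps)
    qed
    then have "v \<bullet> t - e \<le> D \<bullet> t"
      using q_lim by (intro tendsto_lowerbound) auto
    then show ?thesis by simp
  qed
  then have "v \<bullet> t \<le> D \<bullet> t" by (rule field_le_epsilon)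
  then show ?thesis by (simp add: inner_diff_left)
qed simp

text \<open>
  Continuity of the gradient lets it be subtracted along the approximating sequence, which turns
  a limiting subgradient into a limit of Frechet normals of \<open>Z\<close>.
\<close>
lemma limiting_subdiff_smooth_plus_ind:
  fixes f :: "'a::real_inner \<Rightarrow> real"
  assumes v: "v \<in> limiting_subdiff (\<lambda>w. ereal (f w) + ind Z w) x"
    and D: "\<And>x. GDERIV f x :> D x" and cont: "continuous_on UNIV D"
  obtains xs ns where "x \<in> Z" "xs \<longlonglongrightarrow> x" "ns \<longlonglongrightarrow> v - D x" "\<And>k. xs k \<in> Z"
    "\<And>k t. \<forall>\<^sub>F s in at_right 0. xs k + s *\<^sub>R t \<in> Z \<Longrightarrow> ns k \<bullet> t \<le> 0"
proof -
  from v obtain xs vs where xs: "xs \<longlonglongrightarrow> x" and vs: "vs \<longlonglongrightarrow> v"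
    and sub: "\<And>k. vs k \<in> frechet_subdiff (\<lambda>w. ereal (f w) + ind Z w) (xs k)"
    and "\<bar>ereal (f x) + ind Z x\<bar> \<noteq> \<infinity>"
    unfolding limiting_subdiff_def by auto
  then have "x \<in> Z" by (auto simp: ind_def split: if_splits)
  moreover have "(\<lambda>k. D (xs k)) \<longlonglongrightarrow> D x"
    using continuous_on_tendsto_compose[OF cont xs] by simp
  then have "(\<lambda>k. vs k - D (xs k)) \<longlonglongrightarrow> v - D x"
    using vs by (rule tendsto_diff[rotated])
  moreover have "xs k \<in> Z" for k
    using sub by (rule frechet_subdiff_ind_mem)
  moreover have "(vs k - D (xs k)) \<bullet> t \<le> 0" if "\<forall>\<^sub>F s in at_right 0. xs k + s *\<^sub>R t \<in> Z" for k t
    using frechet_subdiff_feasible_direction[OF sub D that] .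
  ultimately show ?thesis using that xs by blast
qed

section \<open>Normals to the complementarity set\<close>

text \<open>
  This says that \<open>n\<close> is the projection of \<open>n\<close> onto the line through \<open>c\<close>, multiplied by
  \<open>c \<bullet> c\<close> which keeps the identity true for \<open>c = 0\<close>.
\<close>
lemma orthogonal_complement_line:
  fixes n c :: "'a::real_inner"
  assumes "\<And>a. a \<bullet> c = 0 \<Longrightarrow> n \<bullet> a = 0"
  shows "(c \<bullet> c) *\<^sub>R n = (n \<bullet> c) *\<^sub>R c"
proof -
  define r where "r = (c \<bullet> c) *\<^sub>R n - (n \<bullet> c) *\<^sub>R c"
  have "r \<bullet> c = 0"
    by (simp add: r_def inner_diff_left)
  moreover from assms[OF this] have "n \<bullet> r = 0" .
  ultimately have "r \<bullet> r = 0"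
    by (simp add: r_def inner_diff_left inner_diff_right inner_commute algebra_simps)
  then show ?thesis by (simp add: r_def)
qed

text \<open>
  With \<open>u = xp + xm\<close>, the line through the base point in direction \<open>(a, b, c)\<close> lies in \<open>Z1\<close> as soon
  as the linear and the quadratic coefficient of the constraint along it vanish. A normal
  is orthogonal to each such line. The lines that move only \<open>xp\<close> and \<open>xm\<close>, or only \<open>\<xi>\<close>, force
  the first two blocks of the normal to be equal and parallel to \<open>\<xi>\<close>, and the third to be
  parallel to \<open>u\<close>. When \<open>\<xi>\<close> and \<open>u\<close> are both nonzero, one further line makes the two factors
  agree: \<open>u\<close> moves along \<open>\<xi>\<close> while \<open>\<xi>\<close> moves along \<open>u\<close>, and the quadratic coefficient
  vanishes because \<open>u \<bullet> \<xi> = 0\<close>.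
\<close>
lemma Z1_normal_gradient_multiple:
  fixes n :: "'n::finite blocks"
  assumes mem: "(xp, xm, \<xi>) \<in> Z1"
    and normal: "\<And>t. \<forall>\<^sub>F s in at_right 0. (xp, xm, \<xi>) + s *\<^sub>R t \<in> Z1 \<Longrightarrow> n \<bullet> t \<le> 0"
  obtains \<mu> where "n = \<mu> *\<^sub>R (\<xi>, \<xi>, xp + xm)"
proof -
  define u where "u = xp + xm"
  obtain n1 n2 n3 where n: "n = (n1, n2, n3)" by (cases n)
  have u\<xi>: "u \<bullet> \<xi> = 0" using mem by (simp add: Z1_def u_def)
  have line: "n \<bullet> t = 0" if "\<And>s. (xp, xm, \<xi>) + s *\<^sub>R t \<in> Z1" for t
  proof (rule antisym)
    show "n \<bullet> t \<le> 0" by (rule normal) (simp add: that)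
    have "n \<bullet> (- t) \<le> 0" using that[of "- s" for s] by (intro normal) simp
    then show "0 \<le> n \<bullet> t" by simp
  qed
  have dir: "n1 \<bullet> a + n2 \<bullet> b + n3 \<bullet> c = 0"
    if "(a + b) \<bullet> \<xi> + u \<bullet> c = 0" "(a + b) \<bullet> c = 0" for a b c
  proof -
    have "(xp, xm, \<xi>) + s *\<^sub>R (a, b, c) \<in> Z1" for s
    proof -
      have "(xp + s *\<^sub>R a + (xm + s *\<^sub>R b)) \<bullet> (\<xi> + s *\<^sub>R c) =
          u \<bullet> \<xi> + s * ((a + b) \<bullet> \<xi> + u \<bullet> c) + s * s * ((a + b) \<bullet> c)"
        by (simp add: u_def inner_add_left inner_add_right algebra_simps)
      then show ?thesis using that u\<xi> by (simp add: Z1_def)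
    qed
    from line[OF this] show ?thesis by (simp add: n inner_prod_def)
  qed
  have "n1 \<bullet> a = n2 \<bullet> a" for a
    using dir[of a "- a" 0] by simp
  then have n12: "n1 = n2"
    by (metis inner_commute vector_eq_rdot)
  have n1: "(\<xi> \<bullet> \<xi>) *\<^sub>R n1 = (n1 \<bullet> \<xi>) *\<^sub>R \<xi>"
    by (rule orthogonal_complement_line) (use dir[of _ 0 0] in simp)
  have n3: "(u \<bullet> u) *\<^sub>R n3 = (n3 \<bullet> u) *\<^sub>R u"
    by (rule orthogonal_complement_line) (use dir[of 0 0] in \<open>simp add: inner_commute\<close>)
  \<comment> \<open>The weights \<open>u \<bullet> u\<close> and \<open>\<xi> \<bullet> \<xi>\<close> cancel the linear coefficient of the constraint.\<close>
  have coupled: "(u \<bullet> u) * (n1 \<bullet> \<xi>) = (\<xi> \<bullet> \<xi>) * (n3 \<bullet> u)"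
    using dir[of "(u \<bullet> u) *\<^sub>R \<xi>" 0 "- (\<xi> \<bullet> \<xi>) *\<^sub>R u"] u\<xi> by (simp add: inner_commute)
  show thesis
  proof (cases "\<xi> = 0")
    case True
    have "n1 = 0" using dir[of n1 0 0] True by simp
    moreover have "n3 = ((n3 \<bullet> u) / (u \<bullet> u)) *\<^sub>R u"
    proof (cases "u = 0")
      case True
      then show ?thesis using dir[of 0 0 n3] by simp
    next
      case False
      then show ?thesis using n3 by (simp add: eq_vector_fraction_iff)
    qed
    ultimately show thesis
      using that[of "(n3 \<bullet> u) / (u \<bullet> u)"] True n12 by (simp add: n u_def)
  next
    case False
    define \<mu> where "\<mu> = (n1 \<bullet> \<xi>) / (\<xi> \<bullet> \<xi>)"
    have "n1 = \<mu> *\<^sub>R \<xi>"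
      using n1 False by (simp add: \<mu>_def eq_vector_fraction_iff)
    moreover have "n3 = \<mu> *\<^sub>R u"
    proof (cases "u = 0")
      case True
      then show ?thesis using dir[of 0 0 n3] by simp
    next
      case u0: False
      have "\<mu> = (n3 \<bullet> u) / (u \<bullet> u)"
        using coupled False u0 by (simp add: \<mu>_def field_simps)
      then show ?thesis using n3 u0 by (simp add: eq_vector_fraction_iff)
    qed
    ultimately show thesis using that[of \<mu>] n12 by (simp add: n u_def)
  qed
qed

text \<open>
  Eliminating the factors, about whose convergence nothing is known, gives the relation
  \<open>(G k \<bullet> G k) *\<^sub>R ns k = (ns k \<bullet> G k) *\<^sub>R G k\<close>, which is closed under limits.
\<close>
lemma limit_of_multiples:
  fixes ns G :: "nat \<Rightarrow> 'a::real_inner"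
  assumes ns: "ns \<longlonglongrightarrow> n" and G: "G \<longlonglongrightarrow> c" and c: "c \<noteq> 0"
    and mult: "\<And>k. \<exists>\<mu>. ns k = \<mu> *\<^sub>R G k"
  obtains \<mu> where "n = \<mu> *\<^sub>R c"
proof -
  have "(\<lambda>k. (G k \<bullet> G k) *\<^sub>R ns k) \<longlonglongrightarrow> (c \<bullet> c) *\<^sub>R n"
    by (intro tendsto_intros ns G)
  moreover have "(G k \<bullet> G k) *\<^sub>R ns k = (ns k \<bullet> G k) *\<^sub>R G k" for k
    using mult[of k] by (auto simp: mult.commute)
  moreover have "(\<lambda>k. (ns k \<bullet> G k) *\<^sub>R G k) \<longlonglongrightarrow> (n \<bullet> c) *\<^sub>R c"
    by (intro tendsto_intros ns G)
  ultimately have "(c \<bullet> c) *\<^sub>R n = (n \<bullet> c) *\<^sub>R c"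
    by (simp add: LIMSEQ_unique)
  then have "n = ((n \<bullet> c) / (c \<bullet> c)) *\<^sub>R c"
    using c by (simp add: eq_vector_fraction_iff)
  then show thesis by (rule that)
qed

section \<open>Normals to a polyhedron\<close>

text \<open>
  Farkas' lemma. A finitely generated convex cone is closed, so a vector outside it could be
  strictly separated from it, and the separating functional would violate the hypothesis.
\<close>
lemma farkas:
  fixes n :: "'a::euclidean_space" and c :: "'i \<Rightarrow> 'a"
  assumes fin: "finite I"
    and dual: "\<And>t. (\<And>i. i \<in> I \<Longrightarrow> c i \<bullet> t \<le> 0) \<Longrightarrow> n \<bullet> t \<le> 0"
  obtains l where "\<And>i. l i \<ge> 0" "n = (\<Sum>i\<in>I. l i *\<^sub>R c i)"
proof -
  define C where "C = convex_cone hull (c ` I)"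
  define K where "K = {(\<Sum>i\<in>I. l i *\<^sub>R c i) |l. \<forall>i. l i \<ge> (0::real)}"
  have cone: "x + y \<in> C" "r \<ge> 0 \<Longrightarrow> r *\<^sub>R x \<in> C" if "x \<in> C" "y \<in> C" for x y r
    using that by (auto simp: C_def intro: convex_cone_hull_add convex_cone_hull_mul)
  have c_C: "c i \<in> C" if "i \<in> I" for i
    using that by (auto simp: C_def intro: hull_inc)
  have "n \<in> C"
  proof (rule ccontr)
    assume "n \<notin> C"
    then obtain a b where a: "a \<bullet> n < b" "\<And>x. x \<in> C \<Longrightarrow> a \<bullet> x > b"
      using separating_hyperplane_closed_point[of C n] fin
      by (auto simp: C_def closed_convex_cone_hull convex_convex_cone_hull)
    have "0 \<in> C" by (simp add: C_def convex_cone_hull_contains_0)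
    with a(2)[of 0] have b: "b < 0" by simp
    have pos: "a \<bullet> x \<ge> 0" if "x \<in> C" for x
    proof (rule ccontr)
      assume neg: "\<not> a \<bullet> x \<ge> 0"
      then have "b / (a \<bullet> x) \<ge> 0" using b by (simp add: divide_nonpos_neg)
      from a(2)[OF cone(2)[OF that that this]] show False using neg by simp
    qed
    have "n \<bullet> (- a) \<le> 0"
      using pos[OF c_C] by (intro dual) (simp add: inner_commute)
    then show False using a(1) b by (simp add: inner_commute)
  qed
  moreover have "C \<subseteq> K"
    unfolding C_def
  proof (rule hull_minimal)
    show "c ` I \<subseteq> K"
    proof safe
      fix i assume "i \<in> I"
      then have "c i = (\<Sum>j\<in>I. (if j = i then 1 else 0) *\<^sub>R c j)"
        using fin by (simp add: if_distrib[of "\<lambda>r. r *\<^sub>R _"] cong: if_cong)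
      then show "c i \<in> K"
        unfolding K_def by (auto intro!: exI[of _ "\<lambda>j. if j = i then 1 else 0"])
    qed
    have "x + y \<in> K" if "x \<in> K" "y \<in> K" for x y
    proof -
      from that obtain l m where "\<forall>i. l i \<ge> 0" "\<forall>i. m i \<ge> 0"
        "x = (\<Sum>i\<in>I. l i *\<^sub>R c i)" "y = (\<Sum>i\<in>I. m i *\<^sub>R c i)"
        by (auto simp: K_def)
      then show ?thesis
        by (auto simp: K_def scaleR_left_distrib sum.distrib intro!: exI[of _ "\<lambda>i. l i + m i"])
    qed
    moreover have "r *\<^sub>R x \<in> K" if "x \<in> K" "r \<ge> 0" for x r
    proof -
      from that obtain l where "\<forall>i. l i \<ge> 0" "x = (\<Sum>i\<in>I. l i *\<^sub>R c i)"
        by (auto simp: K_def)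
      then show ?thesis
        using that by (auto simp: K_def scaleR_sum_right intro!: exI[of _ "\<lambda>i. r * l i"])
    qed
    moreover have "0 \<in> K" by (auto simp: K_def intro!: exI[of _ "\<lambda>i. 0"])
    ultimately show "convex_cone K"
      by (simp add: convex_cone_iff)
  qed
  ultimately show thesis using that by (auto simp: K_def)
qed

text \<open>
  Inactive constraints stay satisfied for a short while in every direction. Hence every direction
  \<open>t\<close> that respects the active constraints is feasible, \<open>n \<bullet> t \<le> 0\<close> holds for it, and Farkas'
  lemma applies to the active constraints alone, which gives complementary slackness.
\<close>
lemma polyhedron_normal_multipliers:
  fixes n x :: "'a::euclidean_space" and a :: "'i \<Rightarrow> 'a"
  assumes fin: "finite I" and x: "\<And>i. i \<in> I \<Longrightarrow> a i \<bullet> x \<le> \<beta> i"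
    and max: "\<And>z. (\<And>i. i \<in> I \<Longrightarrow> a i \<bullet> z \<le> \<beta> i) \<Longrightarrow> n \<bullet> (z - x) \<le> 0"
  obtains l where "\<And>i. l i \<ge> 0" "\<And>i. i \<in> I \<Longrightarrow> l i * (\<beta> i - a i \<bullet> x) = 0"
    "n = (\<Sum>i\<in>I. l i *\<^sub>R a i)"
proof -
  define J where "J = {i \<in> I. a i \<bullet> x = \<beta> i}"
  have "n \<bullet> t \<le> 0" if t: "\<And>i. i \<in> J \<Longrightarrow> a i \<bullet> t \<le> 0" for t
  proof -
    have "\<forall>\<^sub>F s in at_right 0. \<forall>i\<in>I. a i \<bullet> (x + s *\<^sub>R t) \<le> \<beta> i"
    proof (intro eventually_ball_finite fin ballI)
      fix i assume i: "i \<in> I"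
      show "\<forall>\<^sub>F s in at_right 0. a i \<bullet> (x + s *\<^sub>R t) \<le> \<beta> i"
      proof (cases "i \<in> J")
        case True
        show ?thesis
          using eventually_at_right_less[of 0]
        proof eventually_elim
          case (elim s)
          then show ?case
            using t[OF True] True by (simp add: J_def inner_add_right mult_nonneg_nonpos)
        qed
      next
        case False
        have "((\<lambda>s. a i \<bullet> (x + s *\<^sub>R t)) \<longlongrightarrow> a i \<bullet> (x + 0 *\<^sub>R t)) (at_right 0)"
          by (intro tendsto_intros)
        moreover have "a i \<bullet> (x + 0 *\<^sub>R t) < \<beta> i"
          using False i x[OF i] by (simp add: J_def)
        ultimately have "\<forall>\<^sub>F s in at_right 0. a i \<bullet> (x + s *\<^sub>R t) < \<beta> i"
          by (rule order_tendstoD(2))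
        then show ?thesis by eventually_elim simp
      qed
    qed
    then have "\<forall>\<^sub>F s in at_right 0. s * (n \<bullet> t) \<le> 0 \<and> s > 0"
      using eventually_at_right_less[of "0::real"]
    proof eventually_elim
      case (elim s)
      then show ?case using max[of "x + s *\<^sub>R t"] by simp
    qed
    then obtain s where "s * (n \<bullet> t) \<le> 0" "s > 0"
      using eventually_happens by force
    then show ?thesis by (simp add: mult_le_0_iff)
  qed
  moreover have "finite J" using fin by (simp add: J_def)
  ultimately obtain l where l: "\<And>i. l i \<ge> 0" "n = (\<Sum>i\<in>J. l i *\<^sub>R a i)"
    using farkas[of J a n] by blast
  define l' where "l' i = (if i \<in> J then l i else 0)" for i
  have "n = (\<Sum>i\<in>I. l' i *\<^sub>R a i)"
    unfolding l(2) by (rule sum.mono_neutral_cong_left) (auto simp: l'_def J_def fin)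
  then show thesis
    using that[of l'] l(1) by (simp add: l'_def J_def)
qed

lemma convex_Z2:
  fixes A :: "real^'n^'m"
  shows "convex (Z2 A b)"
proof (rule convexI)
  fix y z :: "'n blocks" and s t :: real
  assume yz: "y \<in> Z2 A b" "z \<in> Z2 A b" and st: "0 \<le> s" "0 \<le> t" "s + t = 1"
  obtain y1 y2 y3 z1 z2 z3 where [simp]: "y = (y1, y2, y3)" "z = (z1, z2, z3)"
    by (cases y, cases z) auto
  have cc: "s * p + t * q \<le> r" if "p \<le> r" "q \<le> r" for p q r :: real
    using convex_bound_le[OF that st] .
  have cc': "r \<le> s * p + t * q" if "r \<le> p" "r \<le> q" for p q r :: real
    using cc[of "-p" "-r" "-q"] that by simp
  have "A *v (s *\<^sub>R y1 + t *\<^sub>R z1 - (s *\<^sub>R y2 + t *\<^sub>R z2)) =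
    s *\<^sub>R (A *v (y1 - y2)) + t *\<^sub>R (A *v (z1 - z2))"
    by (simp add: algebra_simps matrix_vector_mult_scaleR)
  then show "s *\<^sub>R y + t *\<^sub>R z \<in> Z2 A b"
    using yz st by (auto simp: Z2_def less_eq_vec_def intro!: cc cc')
qed

lemma sum_scaleR_row:
  fixes A :: "real^'n^'m"
  shows "(\<Sum>j\<in>UNIV. p j *\<^sub>R row j A) = transpose A *v (\<chi> j. p j)"
  by (simp add: vec_eq_iff row_def vector_matrix_mult_def mult.commute)

lemma sum_scaleR_axis:
  "(\<Sum>i\<in>UNIV. l i *\<^sub>R axis i (1::real)) = (\<chi> i. l i)"
  by (simp add: vec_eq_iff axis_def if_distrib cong: if_cong)

text \<open>
  The five groups of constraints of \<open>Z2\<close> are indexed by one sum type, so that the multipliers of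
  the polyhedron split into the five blocks.
\<close>
lemma Z2_normal_multipliers:
  fixes A :: "real^'n^'m" and n :: "'n blocks"
  assumes mem: "(y1, y2, y3) \<in> Z2 A b"
    and max: "\<And>z. z \<in> Z2 A b \<Longrightarrow> n \<bullet> (z - (y1, y2, y3)) \<le> 0"
  obtains \<beta>1 \<beta>2 \<beta>3 \<beta>4 \<pi> where
    "n = (- \<beta>1 - transpose A *v \<pi>, - \<beta>2 + transpose A *v \<pi>, \<beta>4 - \<beta>3)"
    "0 \<le> \<beta>1" "\<beta>1 \<bottom>\<bottom> y1" "0 \<le> \<beta>2" "\<beta>2 \<bottom>\<bottom> y2" "0 \<le> \<beta>3" "\<beta>3 \<bottom>\<bottom> y3"
    "0 \<le> \<beta>4" "\<beta>4 \<bottom>\<bottom> 1 - y3" "0 \<le> \<pi>" "\<pi> \<bottom>\<bottom> A *v (y1 - y2) - b"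
proof -
  define a :: "'n + 'n + 'n + 'n + 'm \<Rightarrow> 'n blocks" where
    "a = case_sum (\<lambda>i. (- axis i 1, 0, 0)) (case_sum (\<lambda>i. (0, - axis i 1, 0))
      (case_sum (\<lambda>i. (0, 0, - axis i 1)) (case_sum (\<lambda>i. (0, 0, axis i 1))
      (\<lambda>j. (- row j A, row j A, 0)))))"
  define \<beta> :: "'n + 'n + 'n + 'n + 'm \<Rightarrow> real" where
    "\<beta> = case_sum (\<lambda>i. 0) (case_sum (\<lambda>i. 0) (case_sum (\<lambda>i. 0) (case_sum (\<lambda>i. 1)
      (\<lambda>j. - b $ j))))"
  have row: "row j A \<bullet> x = (A *v x) $ j" for j x
    by (simp add: matrix_vector_mul_component row_def)
  have all_sum: "(\<forall>i. P i) \<longleftrightarrow> (\<forall>i. P (Inl i)) \<and> (\<forall>i. P (Inr i))" for P :: "'x + 'y \<Rightarrow> bool"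
    by (metis sumE)
  have flip: "q - p \<le> - r \<longleftrightarrow> r \<le> p - q" "- r = q - p \<longleftrightarrow> p - q = r" for p q r :: real
    by linarith+
  have Z2_iff: "z \<in> Z2 A b \<longleftrightarrow> (\<forall>i. a i \<bullet> z \<le> \<beta> i)" for z
    by (cases z) (auto simp: all_sum Z2_def a_def \<beta>_def less_eq_vec_def inner_axis' row
        inner_diff_right matrix_vector_mult_diff_distrib flip)
  obtain l where l: "\<And>i. l i \<ge> 0" "\<And>i. l i * (\<beta> i - a i \<bullet> (y1, y2, y3)) = 0"
    "n = (\<Sum>i\<in>UNIV. l i *\<^sub>R a i)"
    using polyhedron_normal_multipliers[of UNIV a "(y1, y2, y3)" \<beta> n] mem max
    by (auto simp: Z2_iff)
  define \<beta>1 \<beta>2 \<beta>3 \<beta>4 \<pi> where defs: "\<beta>1 = (\<chi> i. l (Inl i))" "\<beta>2 = (\<chi> i. l (Inr (Inl i)))"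
    "\<beta>3 = (\<chi> i. l (Inr (Inr (Inl i))))" "\<beta>4 = (\<chi> i. l (Inr (Inr (Inr (Inl i)))))"
    "\<pi> = (\<chi> j. l (Inr (Inr (Inr (Inr j)))))"
  have sum_sum: "sum F UNIV = (\<Sum>i\<in>UNIV. F (Inl i)) + (\<Sum>i\<in>UNIV. F (Inr i))"
    for F :: "'x::finite + 'y::finite \<Rightarrow> 'n blocks"
    by (simp add: UNIV_Plus_UNIV[symmetric] sum.Plus del: UNIV_Plus_UNIV)
  have "n = (- \<beta>1 - transpose A *v \<pi>, - \<beta>2 + transpose A *v \<pi>, \<beta>4 - \<beta>3)"
    unfolding l(3) defs
    by (rule prod_eqI; (rule prod_eqI)?)
      (simp_all add: sum_sum a_def fst_sum snd_sum sum_negf sum_scaleR_row sum_scaleR_axis)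
  moreover note compl = l(2)[of "Inl i" for i] l(2)[of "Inr (Inl i)" for i]
    l(2)[of "Inr (Inr (Inl i))" for i] l(2)[of "Inr (Inr (Inr (Inl i)))" for i]
    l(2)[of "Inr (Inr (Inr (Inr j)))" for j]
  have "\<beta>1 \<bottom>\<bottom> y1" "\<beta>2 \<bottom>\<bottom> y2" "\<beta>3 \<bottom>\<bottom> y3" "\<beta>4 \<bottom>\<bottom> 1 - y3" "\<pi> \<bottom>\<bottom> A *v (y1 - y2) - b"
    using compl by (simp_all add: perp_def defs a_def \<beta>_def inner_axis' row inner_diff_right
        matrix_vector_mult_diff_distrib flip eq_commute[of 1])
  moreover have "0 \<le> \<beta>1" "0 \<le> \<beta>2" "0 \<le> \<beta>3" "0 \<le> \<beta>4" "0 \<le> \<pi>"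
    using l(1) by (simp_all add: less_eq_vec_def defs)
  ultimately show thesis using that by blast
qed

section \<open>Gradients of the two objectives\<close>

lemma GDERIV_grad:
  assumes "GDERIV f x :> D"
  shows "grad f x = D"
  unfolding grad_def
proof (rule the_equality)
  fix D' assume "GDERIV f x :> D'"
  with assms have "(\<lambda>h. h \<bullet> D) = (\<lambda>h. h \<bullet> D')"
    unfolding gderiv_def by (rule has_derivative_unique)
  then show "D' = D" by (metis vector_eq_ldot)
qed (rule assms)

lemma GDERIV_f_Q:
  assumes "transpose M = M"
  shows "GDERIV (f_Q M d) x :> 2 *\<^sub>R (M *v x) + d"
proof -
  have sym: "x \<bullet> (M *v h) = h \<bullet> (M *v x)" for h
    using assms by (metis dot_lmul_matrix inner_commute transpose_matrix_vector)
  have "((\<lambda>x. x \<bullet> (M *v x) + d \<bullet> x) has_derivative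
      (\<lambda>h. (x \<bullet> (M *v h) + h \<bullet> (M *v x)) + d \<bullet> h)) (at x)"
    by (intro derivative_intros bounded_linear_imp_has_derivative matrix_vector_mul_bounded_linear)
  moreover have "x \<bullet> (M *v h) + h \<bullet> (M *v x) + d \<bullet> h = h \<bullet> (2 *\<^sub>R (M *v x) + d)" for h
    using sym[of h] by (simp add: inner_add_right inner_commute[of d])
  ultimately show ?thesis
    unfolding gderiv_def f_Q_def[abs_def] by (simp only:)
qed

lemma GDERIV_h_fun:
  fixes M :: "real^'n^'n"
  assumes "transpose M = M"
  shows "GDERIV (h_fun M d \<gamma>) (xp, xm, \<xi>) :>
    (grad (f_Q M d) (xp - xm), - grad (f_Q M d) (xp - xm), - (\<gamma> *\<^sub>R 1))"
proof -
  have "((\<lambda>w. f_Q M d (fst w - fst (snd w))) has_derivative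
      (\<lambda>h. (fst h - fst (snd h)) \<bullet> grad (f_Q M d) (xp - xm))) (at (xp, xm, \<xi>))"
  proof (rule has_derivative_compose[where g = "f_Q M d"])
    show "((\<lambda>w. fst w - fst (snd w)) has_derivative (\<lambda>h. fst h - fst (snd h))) (at (xp, xm, \<xi>))"
      by (auto intro!: derivative_eq_intros)
    show "(f_Q M d has_derivative (\<lambda>h. h \<bullet> grad (f_Q M d) (xp - xm)))
        (at (fst (xp, xm, \<xi>) - fst (snd (xp, xm, \<xi>))))"
      using GDERIV_f_Q[OF assms, of d "xp - xm"] by (simp add: GDERIV_grad gderiv_def)
  qed
  then have "((\<lambda>w. f_Q M d (fst w - fst (snd w)) + \<gamma> * (1 \<bullet> (1 - snd (snd w)))) has_derivative
      (\<lambda>h. (fst h - fst (snd h)) \<bullet> grad (f_Q M d) (xp - xm) + \<gamma> * (1 \<bullet> (0 - snd (snd h)))))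
      (at (xp, xm, \<xi>))"
    by (intro derivative_intros)
  moreover have "(fst h - fst (snd h)) \<bullet> grad (f_Q M d) (xp - xm) + \<gamma> * (1 \<bullet> (0 - snd (snd h))) =
      h \<bullet> (grad (f_Q M d) (xp - xm), - grad (f_Q M d) (xp - xm), - (\<gamma> *\<^sub>R 1))"
    for h :: "'n blocks"
    by (simp add: inner_prod_def inner_diff_left inner_commute[of _ "snd (snd h)"])
  ultimately show ?thesis
    by (simp only: gderiv_def h_fun_def case_prod_beta')
qed

lemma GDERIV_p_fun:
  assumes "smooth g"
  shows "GDERIV (p_fun g) (y1, y2, y3) :> (grad g (y1 - y2), - grad g (y1 - y2), 0)"
proof -
  have "((\<lambda>w. g (fst w - fst (snd w))) has_derivative
      (\<lambda>h. (fst h - fst (snd h)) \<bullet> grad g (y1 - y2))) (at (y1, y2, y3))"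
  proof (rule has_derivative_compose[where g = g])
    show "((\<lambda>w. fst w - fst (snd w)) has_derivative (\<lambda>h. fst h - fst (snd h))) (at (y1, y2, y3))"
      by (auto intro!: derivative_eq_intros)
    show "(g has_derivative (\<lambda>h. h \<bullet> grad g (y1 - y2)))
        (at (fst (y1, y2, y3) - fst (snd (y1, y2, y3))))"
      using assms by (simp add: smooth_def gderiv_def)
  qed
  then show ?thesis
    by (simp add: gderiv_def p_fun_def case_prod_beta' inner_prod_def inner_diff_left)
qed

section \<open>Multipliers for the two subproblems\<close>

lemma h_plus_Z1_multiplier:
  fixes M :: "real^'n^'n"
  assumes M: "transpose M = M"
    and v: "v \<in> limiting_subdiff (\<lambda>w. ereal (h_fun M d \<gamma> w) + ind Z1 w) (xp, xm, \<xi>)"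
    and nz: "(\<xi>, \<xi>, xp + xm) \<noteq> 0"
  obtains \<mu> where "(xp + xm) \<bullet> \<xi> = 0"
    "v = (grad (f_Q M d) (xp - xm), - grad (f_Q M d) (xp - xm), - (\<gamma> *\<^sub>R 1))
       + \<mu> *\<^sub>R (\<xi>, \<xi>, xp + xm)"
proof -
  define D where "D w = (grad (f_Q M d) (fst w - fst (snd w)),
    - grad (f_Q M d) (fst w - fst (snd w)), - (\<gamma> *\<^sub>R (1::real^'n)))" for w :: "'n blocks"
  define G where "G w = (snd (snd w), snd (snd w), fst w + fst (snd w))" for w :: "'n blocks"
  have "grad (f_Q M d) = (\<lambda>x. 2 *\<^sub>R (M *v x) + d)"
    using GDERIV_grad[OF GDERIV_f_Q[OF M]] by blast
  then have "continuous_on UNIV D"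
    unfolding D_def by (simp, intro continuous_intros matrix_vector_mult_linear_continuous_on
        linear_continuous_on_compose[OF _ matrix_vector_mul_linear])
  moreover have "GDERIV (h_fun M d \<gamma>) w :> D w" for w
    using GDERIV_h_fun[OF M] by (cases w) (simp add: D_def)
  ultimately obtain xs ns where Z1: "(xp, xm, \<xi>) \<in> Z1"
    and xs: "xs \<longlonglongrightarrow> (xp, xm, \<xi>)" and ns: "ns \<longlonglongrightarrow> v - D (xp, xm, \<xi>)"
    and mem: "\<And>k. xs k \<in> Z1"
    and normal: "\<And>k t. \<forall>\<^sub>F s in at_right 0. xs k + s *\<^sub>R t \<in> Z1 \<Longrightarrow> ns k \<bullet> t \<le> 0"
    using limiting_subdiff_smooth_plus_ind[OF v, of D] by blast
  have "\<exists>\<mu>. ns k = \<mu> *\<^sub>R G (xs k)" for k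
  proof -
    obtain a b c where abc: "xs k = (a, b, c)" by (cases "xs k")
    show ?thesis
      using Z1_normal_gradient_multiple[OF mem[of k, unfolded abc] normal[of k, unfolded abc]]
      by (auto simp: G_def abc)
  qed
  moreover have "(\<lambda>k. G (xs k)) \<longlonglongrightarrow> G (xp, xm, \<xi>)"
    unfolding G_def by (intro tendsto_intros xs)
  moreover have "G (xp, xm, \<xi>) \<noteq> 0" using nz by (simp add: G_def)
  ultimately obtain \<mu> where "v - D (xp, xm, \<xi>) = \<mu> *\<^sub>R G (xp, xm, \<xi>)"
    using limit_of_multiples[OF ns, of "\<lambda>k. G (xs k)" "G (xp, xm, \<xi>)"] by blast
  then have "v = D (xp, xm, \<xi>) + \<mu> *\<^sub>R G (xp, xm, \<xi>)" by (simp add: algebra_simps)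
  then show thesis using that[of \<mu>] Z1 by (simp add: D_def G_def Z1_def)
qed

text \<open>
  The segment from the approximating point to any \<open>z\<close> stays in \<open>Z2\<close>, so the Frechet normals satisfy
  a variational inequality against each fixed \<open>z\<close>, which is stable under limits.
\<close>
lemma p_plus_Z2_normal:
  fixes A :: "real^'n^'m"
  assumes g: "smooth g"
    and v: "v \<in> limiting_subdiff (\<lambda>y. ereal (p_fun g y) + ind (Z2 A b) y) (y1, y2, y3)"
  shows "(y1, y2, y3) \<in> Z2 A b"
    and "z \<in> Z2 A b \<Longrightarrow>
      (v - (grad g (y1 - y2), - grad g (y1 - y2), 0)) \<bullet> (z - (y1, y2, y3)) \<le> 0"
proof -
  define D where "D w = (grad g (fst w - fst (snd w)),
    - grad g (fst w - fst (snd w)), 0::real^'n)" for w :: "'n blocks"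
  have cg: "continuous_on UNIV (grad g)" using g by (simp add: smooth_def)
  have "continuous_on UNIV D"
    unfolding D_def by (intro continuous_intros continuous_on_compose2[OF cg]) auto
  moreover have "GDERIV (p_fun g) w :> D w" for w
    using GDERIV_p_fun[OF g] by (cases w) (simp add: D_def)
  ultimately obtain xs ns where Z2: "(y1, y2, y3) \<in> Z2 A b"
    and xs: "xs \<longlonglongrightarrow> (y1, y2, y3)" and ns: "ns \<longlonglongrightarrow> v - D (y1, y2, y3)"
    and mem: "\<And>k. xs k \<in> Z2 A b"
    and normal: "\<And>k t. \<forall>\<^sub>F s in at_right 0. xs k + s *\<^sub>R t \<in> Z2 A b \<Longrightarrow> ns k \<bullet> t \<le> 0"
    using limiting_subdiff_smooth_plus_ind[OF v, of D] by blast
  show "(y1, y2, y3) \<in> Z2 A b" by (fact Z2)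
  assume z: "z \<in> Z2 A b"
  have "ns k \<bullet> (z - xs k) \<le> 0" for k
  proof (rule normal)
    have "\<forall>\<^sub>F s in at_right (0::real). 0 < s \<and> s < 1"
      by (auto simp: eventually_at_right_field intro!: exI[of _ 1])
    then show "\<forall>\<^sub>F s in at_right 0. xs k + s *\<^sub>R (z - xs k) \<in> Z2 A b"
    proof eventually_elim
      case (elim s)
      then have "(1 - s) *\<^sub>R xs k + s *\<^sub>R z \<in> Z2 A b"
        using convexD[OF convex_Z2 mem z, of "1 - s" s] by simp
      then show ?case by (simp add: algebra_simps)
    qed
  qed
  moreover have "(\<lambda>k. ns k \<bullet> (z - xs k)) \<longlonglongrightarrow> (v - D (y1, y2, y3)) \<bullet> (z - (y1, y2, y3))"
    by (intro tendsto_intros ns xs)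
  ultimately have "(v - D (y1, y2, y3)) \<bullet> (z - (y1, y2, y3)) \<le> 0"
    by (intro tendsto_upperbound) auto
  then show "(v - (grad g (y1 - y2), - grad g (y1 - y2), 0)) \<bullet> (z - (y1, y2, y3)) \<le> 0"
    by (simp add: D_def)
qed

theorem theorem3:
  fixes A :: "real^'n^'m" and b :: "real^'m" and \<gamma> \<alpha> :: real
    and M :: "real^'n^'n" and d :: "real^'n" and g :: "real^'n \<Rightarrow> real"
    and xp xm \<xi> y1 y2 y3 :: "real^'n" and lam :: "'n blocks"
  assumes "\<gamma> > 0" and "transpose M = M"
    and "smooth g" and "convex_on UNIV g"
    and "\<alpha> > 0"
    and "0 \<in> {v + lam |v. v \<in> limiting_subdiff (\<lambda>w. ereal (h_fun M d \<gamma> w) + ind Z1 w) (xp, xm, \<xi>)}"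
    and "0 \<in> {v - lam |v. v \<in> limiting_subdiff (\<lambda>y. ereal (p_fun g y) + ind (Z2 A b) y) (y1, y2, y3)}"
    and "(xp, xm, \<xi>) - (y1, y2, y3) = \<alpha> *\<^sub>R lam"
    and "(\<xi>, \<xi>, xp + xm) \<noteq> 0"
  shows "\<exists>(\<mu>::real) (\<beta>1::real^'n) (\<beta>2::real^'n) (\<beta>3::real^'n) (\<beta>4::real^'n) (\<pi>::real^'m).
     (grad (f_Q M d) (xp - xm) + grad g (y1 - y2),
      - grad (f_Q M d) (xp - xm) - grad g (y1 - y2),
      - (\<gamma> *\<^sub>R (1::real^'n)))
     + (\<mu> *\<^sub>R \<xi> - \<beta>1 - transpose A *v \<pi>,
        \<mu> *\<^sub>R \<xi> - \<beta>2 + transpose A *v \<pi>,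
        \<mu> *\<^sub>R (xp + xm) + \<beta>4 - \<beta>3) = 0
     \<and> 0 \<le> \<beta>1 \<and> \<beta>1 \<bottom>\<bottom> y1 \<and> y1 \<ge> 0
     \<and> 0 \<le> \<beta>2 \<and> \<beta>2 \<bottom>\<bottom> y2 \<and> y2 \<ge> 0
     \<and> 0 \<le> \<beta>3 \<and> \<beta>3 \<bottom>\<bottom> y3 \<and> y3 \<ge> 0
     \<and> 0 \<le> \<beta>4 \<and> \<beta>4 \<bottom>\<bottom> 1 - y3 \<and> 1 - y3 \<ge> 0
     \<and> 0 \<le> \<pi> \<and> \<pi> \<bottom>\<bottom> A *v (y1 - y2) - b \<and> A *v (y1 - y2) - b \<ge> 0
     \<and> (xp + xm) \<bullet> \<xi> = 0
     \<and> (xp, xm, \<xi>) - (y1, y2, y3) = \<alpha> *\<^sub>R lam"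
proof -
  define f' where "f' = grad (f_Q M d) (xp - xm)"
  define g' where "g' = grad g (y1 - y2)"
  obtain v where v: "0 = v + lam"
    "v \<in> limiting_subdiff (\<lambda>w. ereal (h_fun M d \<gamma> w) + ind Z1 w) (xp, xm, \<xi>)"
    using assms(6) unfolding mem_Collect_eq by (elim exE conjE)
  from v(1) have "v = - lam" by (simp only: eq_neg_iff_add_eq_0)
  with v(2) have
    "- lam \<in> limiting_subdiff (\<lambda>w. ereal (h_fun M d \<gamma> w) + ind Z1 w) (xp, xm, \<xi>)"
    by (simp only:)
  then obtain \<mu> where compl: "(xp + xm) \<bullet> \<xi> = 0"
    and \<mu>: "- lam = (f', - f', - (\<gamma> *\<^sub>R 1)) + \<mu> *\<^sub>R (\<xi>, \<xi>, xp + xm)"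
    unfolding f'_def by (rule h_plus_Z1_multiplier[OF assms(2) _ assms(9)])
  obtain u where u: "0 = u - lam"
    "u \<in> limiting_subdiff (\<lambda>y. ereal (p_fun g y) + ind (Z2 A b) y) (y1, y2, y3)"
    using assms(7) unfolding mem_Collect_eq by (elim exE conjE)
  from u(1) have "u = lam" by (metis right_minus_eq)
  with u(2) have "lam \<in> limiting_subdiff (\<lambda>y. ereal (p_fun g y) + ind (Z2 A b) y) (y1, y2, y3)"
    by (simp only:)
  note y = p_plus_Z2_normal[OF assms(3) this]
  obtain \<beta>1 \<beta>2 \<beta>3 \<beta>4 \<pi> where
    \<beta>: "lam - (g', - g', 0) = (- \<beta>1 - transpose A *v \<pi>, - \<beta>2 + transpose A *v \<pi>, \<beta>4 - \<beta>3)"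
    "0 \<le> \<beta>1" "\<beta>1 \<bottom>\<bottom> y1" "0 \<le> \<beta>2" "\<beta>2 \<bottom>\<bottom> y2" "0 \<le> \<beta>3" "\<beta>3 \<bottom>\<bottom> y3"
    "0 \<le> \<beta>4" "\<beta>4 \<bottom>\<bottom> 1 - y3" "0 \<le> \<pi>" "\<pi> \<bottom>\<bottom> A *v (y1 - y2) - b"
    unfolding g'_def by (rule Z2_normal_multipliers[OF y])
  have "(f' + g', - f' - g', - (\<gamma> *\<^sub>R (1::real^'n)))
     + (\<mu> *\<^sub>R \<xi> - \<beta>1 - transpose A *v \<pi>, \<mu> *\<^sub>R \<xi> - \<beta>2 + transpose A *v \<pi>,
        \<mu> *\<^sub>R (xp + xm) + \<beta>4 - \<beta>3)
     = ((f', - f', - (\<gamma> *\<^sub>R 1)) + \<mu> *\<^sub>R (\<xi>, \<xi>, xp + xm)) + ((g', - g', 0)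
        + (- \<beta>1 - transpose A *v \<pi>, - \<beta>2 + transpose A *v \<pi>, \<beta>4 - \<beta>3))"
    by simp
  also have "\<dots> = - lam + ((g', - g', 0) + (lam - (g', - g', 0)))"
    by (simp only: \<mu> \<beta>(1))
  also have "\<dots> = 0"
    by (simp only: add_diff_eq add_diff_cancel_left' ab_left_minus)
  finally have "(f' + g', - f' - g', - (\<gamma> *\<^sub>R (1::real^'n)))
     + (\<mu> *\<^sub>R \<xi> - \<beta>1 - transpose A *v \<pi>, \<mu> *\<^sub>R \<xi> - \<beta>2 + transpose A *v \<pi>,
        \<mu> *\<^sub>R (xp + xm) + \<beta>4 - \<beta>3) = 0" .
  moreover have "y1 \<ge> 0" "y2 \<ge> 0" "y3 \<ge> 0" "1 - y3 \<ge> 0" "A *v (y1 - y2) - b \<ge> 0"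
    using y(1) by (simp_all add: Z2_def)
  ultimately show ?thesis
    unfolding f'_def g'_def
    by (intro exI[of _ \<mu>] exI[of _ \<beta>1] exI[of _ \<beta>2] exI[of _ \<beta>3] exI[of _ \<beta>4] exI[of _ \<pi>]
        conjI \<beta>(2-) compl assms(8))
qed

end
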